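(* Let $\mathbf{Z}=\begin{pmatrix}\mathbf{X}\\ \mathbf{Y}\end{pmatrix}=[\mathbf{z}_1\,|\,\mathbf{z}_2]\in\mathbb{R}^{4\times2}$ be a Lagrangian frame, let $\mathbf{U}=\mathbf{z}_1\wedge\mathbf{z}_2$, and let $\kappa$ be its Maslov angle, i.e. the real number, defined up to addition of a multiple of $2\pi$, with $e^{\mathrm{i}\kappa}=\det\left((\mathbf{X}-\mathrm{i}\mathbf{Y})(\mathbf{X}+\mathrm{i}\mathbf{Y})^{-1}\right)$. Then $$e^{\mathrm{i}\kappa}=\frac{K(\mathbf{U})}{\overline{K(\mathbf{U})}} .$$
   Context: $\mathbf{J}=\begin{pmatrix}\mathbf{0}&-\mathbf{I}\\ \mathbf{I}&\mathbf{0}\end{pmatrix}$ is the standard symplectic operator on $\mathbb{R}^4$ ($2\times2$ blocks). A Lagrangian frame is a real $4\times2$ matrix $\mathbf{Z}$ of rank 2, with columns $\mathbf{z}_1,\mathbf{z}_2$ satisfying $\langle\mathbf{J}\mathbf{z}_1,\mathbf{z}_2\rangle=0$; it is partitioned into $2\times2$ real blocks $\mathbf{X}$ (top) and $\mathbf{Y}$ (bottom). $\mathrm{vol}=\mathbf{e}_1\wedge\mathbf{e}_2\wedge\mathbf{e}_3\wedge\mathbf{e}_4$. The complex-valued scalar function $K$ is defined by $\mathbf{C}\wedge\mathbf{U}=K(\mathbf{U})\,\mathrm{vol}$, where $\mathbf{C}=\mathbf{C}_1+\mathrm{i}\mathbf{C}_2$, $\mathbf{C}_1,\mathbf{C}_2\in\bigwedge^2(\mathbb{R}^4)$,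 is a complex $2$-form such that $\det[\mathbf{X}-\mathrm{i}\mathbf{Y}]\,\mathrm{vol}=\mathbf{C}\wedge(\mathbf{z}_1\wedge\mathbf{z}_2)$ for every Lagrangian frame; such a form is $\mathbf{C}=-\mathbf{e}_1\wedge\mathbf{e}_2+\mathbf{e}_3\wedge\mathbf{e}_4+\mathrm{i}(\mathbf{e}_1\wedge\mathbf{e}_4-\mathbf{e}_2\wedge\mathbf{e}_3)$. *)

theory Defs
  imports "HOL-Analysis.Analysis"
begin

section \<open>The exterior algebra of a coordinate space\<close>

text \<open>
  An element of the exterior algebra over \<open>'a ^ 'n\<close> is given by its coordinates with respect
  to the basis \<open>e_S = e_(i1) \<and> ... \<and> e_(ik)\<close>, where \<open>S = {i1 < ... < ik}\<close> ranges over the subsets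
  of \<open>'n\<close>. In the type \<open>4\<close> the numeral \<open>4\<close> equals \<open>0\<close> and is the least element, so that
  \<open>e_UNIV\<close> is \<open>e4 \<and> e1 \<and> e2 \<and> e3\<close>, which is minus the volume form. For this reason nothing below
  refers to a basis element \<open>e_S\<close> with more than one factor: these are always
  written out as wedge products of the \<open>bvec i\<close>.
\<close>

type_synonym ('a, 'n) exterior = "('a, 'n set) vec"

definition shuffle_sign :: "'n::linorder set \<Rightarrow> 'n set \<Rightarrow> 'a::comm_ring_1"
  where "shuffle_sign A B = (- 1) ^ card {(i, j). i \<in> A \<and> j \<in> B \<and> j < i}"

definition wedge :: "('a::comm_ring_1, 'n::{finite,linorder}) exterior \<Rightarrow> ('a, 'n) exterior
    \<Rightarrow> ('a, 'n) exterior"  (infixr "\<and>\<^sub>e" 75)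
  where "a \<and>\<^sub>e b = (\<chi> S. \<Sum>A\<in>Pow S. shuffle_sign A (S - A) * a $ A * b $ (S - A))"

definition homogeneous :: "nat \<Rightarrow> ('a::zero, 'n::finite) exterior \<Rightarrow> bool"
  where "homogeneous k a \<longleftrightarrow> (\<forall>S. a $ S \<noteq> 0 \<longrightarrow> card S = k)"

definition bvec :: "'n::finite \<Rightarrow> ('a::zero_neq_one, 'n) exterior"
  where "bvec i = axis {i} 1"

definition cvec :: "real ^ 'n::finite \<Rightarrow> (complex, 'n) exterior"
  where "cvec v = (\<Sum>i\<in>UNIV. of_real (v $ i) *s bvec i)"

definition vol :: "(complex, 4) exterior"
  where "vol = bvec 1 \<and>\<^sub>e bvec 2 \<and>\<^sub>e bvec 3 \<and>\<^sub>e bvec 4"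


section \<open>Lagrangian frames and the Maslov angle\<close>

definition symplectic_J :: "real ^ 4 ^ 4"
  where "symplectic_J = vector
    [vector [0, 0, - 1, 0],
     vector [0, 0, 0, - 1],
     vector [1, 0, 0, 0],
     vector [0, 1, 0, 0]]"

definition lagrangian_frame :: "real ^ 2 ^ 4 \<Rightarrow> bool"
  where "lagrangian_frame Z \<longleftrightarrow>
    rank Z = 2 \<and> (symplectic_J *v column 1 Z) \<bullet> column 2 Z = 0"

definition upper_block :: "real ^ 2 ^ 4 \<Rightarrow> real ^ 2 ^ 2"
  where "upper_block Z = vector [Z $ 1, Z $ 2]"

definition lower_block :: "real ^ 2 ^ 4 \<Rightarrow> real ^ 2 ^ 2"
  where "lower_block Z = vector [Z $ 3, Z $ 4]"

definition X_plus_iY :: "real ^ 2 ^ 4 \<Rightarrow> complex ^ 2 ^ 2"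
  where "X_plus_iY Z =
    (\<chi> i j. of_real (upper_block Z $ i $ j) + \<i> * of_real (lower_block Z $ i $ j))"

definition X_minus_iY :: "real ^ 2 ^ 4 \<Rightarrow> complex ^ 2 ^ 2"
  where "X_minus_iY Z =
    (\<chi> i j. of_real (upper_block Z $ i $ j) - \<i> * of_real (lower_block Z $ i $ j))"

definition maslov_angle :: "real ^ 2 ^ 4 \<Rightarrow> real \<Rightarrow> bool"
  where "maslov_angle Z \<kappa> \<longleftrightarrow>
    exp (\<i> * of_real \<kappa>) = det (X_minus_iY Z ** matrix_inv (X_plus_iY Z))"

definition frame_wedge :: "real ^ 2 ^ 4 \<Rightarrow> (complex, 4) exterior"
  where "frame_wedge Z = cvec (column 1 Z) \<and>\<^sub>e cvec (column 2 Z)"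

definition maslov_form :: "(complex, 4) exterior \<Rightarrow> bool"
  where "maslov_form C \<longleftrightarrow> homogeneous 2 C \<and>
    (\<forall>Z. lagrangian_frame Z \<longrightarrow> det (X_minus_iY Z) *s vol = C \<and>\<^sub>e frame_wedge Z)"

definition K :: "(complex, 4) exterior \<Rightarrow> (complex, 4) exterior \<Rightarrow> complex"
  where "K C U = (THE k. C \<and>\<^sub>e U = k *s vol)"

definition standard_maslov_form :: "(complex, 4) exterior"
  where "standard_maslov_form =
    - (bvec 1 \<and>\<^sub>e bvec 2) + bvec 3 \<and>\<^sub>e bvec 4 + \<i> *s (bvec 1 \<and>\<^sub>e bvec 4 - bvec 2 \<and>\<^sub>e bvec 3)"


section \<open>The definitions are meaningful\<close>

lemma wedge_add_left: "(a + b) \<and>\<^sub>e c = a \<and>\<^sub>e c + b \<and>\<^sub>e c"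
  by (simp add: wedge_def vec_eq_iff algebra_simps sum.distrib)

lemma wedge_add_right: "c \<and>\<^sub>e (a + b) = c \<and>\<^sub>e a + c \<and>\<^sub>e b"
  by (simp add: wedge_def vec_eq_iff algebra_simps sum.distrib)

lemma wedge_scale_left: "(k *s a) \<and>\<^sub>e c = k *s (a \<and>\<^sub>e c)"
  by (simp add: wedge_def vec_eq_iff algebra_simps sum_distrib_left)

lemma wedge_scale_right: "c \<and>\<^sub>e (k *s a) = k *s (c \<and>\<^sub>e a)"
  by (simp add: wedge_def vec_eq_iff algebra_simps sum_distrib_left)

lemma wedge_uminus_left: "(- a) \<and>\<^sub>e c = - (a \<and>\<^sub>e c)"
  by (simp add: wedge_def vec_eq_iff sum_negf)

lemma wedge_uminus_right: "c \<and>\<^sub>e (- a) = - (c \<and>\<^sub>e a)"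
  by (simp add: wedge_def vec_eq_iff sum_negf)

lemma wedge_diff_left: "(a - b) \<and>\<^sub>e c = a \<and>\<^sub>e c - b \<and>\<^sub>e c"
  by (simp add: wedge_def vec_eq_iff algebra_simps sum_subtractf)

lemma wedge_axis:
  "axis A 1 \<and>\<^sub>e axis B 1 =
    (if A \<inter> B = {} then shuffle_sign A B *s axis (A \<union> B) 1
     else (0::('a::comm_ring_1, 'n::{finite,linorder}) exterior))"
proof -
  have "(\<Sum>D\<in>Pow S. shuffle_sign D (S - D) * axis A 1 $ D * axis B 1 $ (S - D)) =
    (if A \<inter> B = {} then shuffle_sign A B * axis (A \<union> B) 1 $ S else (0::'a))" for S
  proof -
    have "(\<Sum>D\<in>Pow S. shuffle_sign D (S - D) * axis A 1 $ D * axis B 1 $ (S - D)) =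
      (\<Sum>D\<in>Pow S. if D = A then shuffle_sign A (S - A) * axis B 1 $ (S - A) else (0::'a))"
      by (rule sum.cong) (auto simp: axis_def)
    also have "\<dots> = (if A \<subseteq> S then shuffle_sign A (S - A) * axis B 1 $ (S - A) else 0)"
      by (simp add: sum.delta)
    also have "\<dots> = (if A \<inter> B = {} then shuffle_sign A B * axis (A \<union> B) 1 $ S else 0)"
    proof (cases "A \<subseteq> S \<and> S - A = B")
      case True
      then have "S = A \<union> B" "A \<inter> B = {}" by auto
      then show ?thesis using True by (simp add: axis_def)
    next
      case False
      then have "\<not> (A \<inter> B = {} \<and> S = A \<union> B)" by auto
      then show ?thesis using False by (auto simp: axis_def)
    qed
    finally show ?thesis .
  qed
  then show ?thesis
    by (auto simp: wedge_def vec_eq_iff)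
qed

lemma less_4: "(1::4) < 2" "(1::4) < 3" "(2::4) < 3" "(4::4) < 1" "(4::4) < 2" "(4::4) < 3"
  by (simp_all add: less_bit0_def bit0.Rep_numeral bit0.Rep_1 bit0.Rep_0)

lemma not_less_4:
  "\<not> (2::4) < 1" "\<not> (3::4) < 1" "\<not> (3::4) < 2" "\<not> (1::4) < 4" "\<not> (2::4) < 4" "\<not> (3::4) < 4"
  using less_4 by (metis less_asym)+

lemma distinct_4: "(1::4) \<noteq> 2" "(1::4) \<noteq> 3" "(2::4) \<noteq> 3" "(4::4) \<noteq> 1" "(4::4) \<noteq> 2" "(4::4) \<noteq> 3"
  using less_4 by (metis less_irrefl)+

lemma vector_4:
  "(vector [a, b, c, d] :: 'a::zero ^ 4) $ 1 = a"
  "(vector [a, b, c, d] :: 'a::zero ^ 4) $ 2 = b"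
  "(vector [a, b, c, d] :: 'a::zero ^ 4) $ 3 = c"
  "(vector [a, b, c, d] :: 'a::zero ^ 4) $ 4 = d"
  unfolding vector_def by simp_all

lemma shuffle_sign_prod:
  "shuffle_sign A B = (\<Prod>i\<in>A. \<Prod>j\<in>B. if j < i then - 1 else (1::'a::comm_ring_1))"
  for A B :: "'n::{finite,linorder} set"
proof -
  have "(\<Prod>i\<in>A. \<Prod>j\<in>B. if j < i then - 1 else (1::'a)) =
      (\<Prod>p\<in>A \<times> B. if snd p < fst p then - 1 else 1)"
    by (simp add: prod.cartesian_product case_prod_unfold)
  also have "\<dots> = (\<Prod>p\<in>{p \<in> A \<times> B. snd p < fst p}. - 1)"
    by (rule prod.inter_filter [symmetric]) simp
  also have "{p \<in> A \<times> B. snd p < fst p} = {(i, j). i \<in> A \<and> j \<in> B \<and> j < i}"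
    by auto
  finally show ?thesis
    by (simp add: shuffle_sign_def)
qed

lemma wedge_bvec:
  "bvec i \<and>\<^sub>e bvec j = - (bvec j \<and>\<^sub>e (bvec i :: ('a::comm_ring_1, 'n::{finite,linorder}) exterior))"
  by (cases i j rule: linorder_cases)
    (auto simp: bvec_def wedge_axis shuffle_sign_prod insert_commute vector_sneg_minus1)

lemma wedge_bvec_self: "bvec i \<and>\<^sub>e bvec i = (0 :: ('a::comm_ring_1, 'n::{finite,linorder}) exterior)"
  by (simp add: bvec_def wedge_axis)

lemma homogeneous_wedge:
  assumes "homogeneous k a" "homogeneous l b"
  shows "homogeneous (k + l) (a \<and>\<^sub>e b)"
  unfolding homogeneous_def
proof (intro allI impI)
  fix S
  assume "(a \<and>\<^sub>e b) $ S \<noteq> 0"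
  then have "\<exists>A\<in>Pow S. shuffle_sign A (S - A) * a $ A * b $ (S - A) \<noteq> 0"
    unfolding wedge_def using sum.neutral by fastforce
  then obtain A where A: "A \<subseteq> S" "a $ A \<noteq> 0" "b $ (S - A) \<noteq> 0"
    by (metis PowD mult_zero_left mult_zero_right)
  then have "card A = k" "card (S - A) = l"
    using assms by (auto simp: homogeneous_def)
  then show "card S = k + l"
    using A(1) by (metis card_Diff_subset card_mono finite le_add_diff_inverse)
qed

lemma homogeneous_bvec: "homogeneous 1 (bvec i)"
  by (auto simp: homogeneous_def bvec_def axis_def)

lemma vol_eq: "vol = - axis UNIV 1"
  unfolding vol_def bvec_def UNIV_4
  by (simp add: wedge_axis shuffle_sign_prod less_4 not_less_4 distinct_4
      distinct_4[symmetric] wedge_scale_right wedge_scale_left wedge_uminus_right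
      insert_commute)

lemma wedge_basis_4:
  "(bvec 1 \<and>\<^sub>e bvec 2) \<and>\<^sub>e (bvec 1 \<and>\<^sub>e bvec 2) = (0 :: (complex, 4) exterior)"
  "(bvec 1 \<and>\<^sub>e bvec 2) \<and>\<^sub>e (bvec 1 \<and>\<^sub>e bvec 3) = (0 :: (complex, 4) exterior)"
  "(bvec 1 \<and>\<^sub>e bvec 2) \<and>\<^sub>e (bvec 1 \<and>\<^sub>e bvec 4) = (0 :: (complex, 4) exterior)"
  "(bvec 1 \<and>\<^sub>e bvec 2) \<and>\<^sub>e (bvec 2 \<and>\<^sub>e bvec 3) = (0 :: (complex, 4) exterior)"
  "(bvec 1 \<and>\<^sub>e bvec 2) \<and>\<^sub>e (bvec 2 \<and>\<^sub>e bvec 4) = (0 :: (complex, 4) exterior)"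
  "(bvec 1 \<and>\<^sub>e bvec 2) \<and>\<^sub>e (bvec 3 \<and>\<^sub>e bvec 4) = vol"
  "(bvec 3 \<and>\<^sub>e bvec 4) \<and>\<^sub>e (bvec 1 \<and>\<^sub>e bvec 2) = vol"
  "(bvec 3 \<and>\<^sub>e bvec 4) \<and>\<^sub>e (bvec 1 \<and>\<^sub>e bvec 3) = (0 :: (complex, 4) exterior)"
  "(bvec 3 \<and>\<^sub>e bvec 4) \<and>\<^sub>e (bvec 1 \<and>\<^sub>e bvec 4) = (0 :: (complex, 4) exterior)"
  "(bvec 3 \<and>\<^sub>e bvec 4) \<and>\<^sub>e (bvec 2 \<and>\<^sub>e bvec 3) = (0 :: (complex, 4) exterior)"
  "(bvec 3 \<and>\<^sub>e bvec 4) \<and>\<^sub>e (bvec 2 \<and>\<^sub>e bvec 4) = (0 :: (complex, 4) exterior)"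
  "(bvec 3 \<and>\<^sub>e bvec 4) \<and>\<^sub>e (bvec 3 \<and>\<^sub>e bvec 4) = (0 :: (complex, 4) exterior)"
  "(bvec 1 \<and>\<^sub>e bvec 4) \<and>\<^sub>e (bvec 1 \<and>\<^sub>e bvec 2) = (0 :: (complex, 4) exterior)"
  "(bvec 1 \<and>\<^sub>e bvec 4) \<and>\<^sub>e (bvec 1 \<and>\<^sub>e bvec 3) = (0 :: (complex, 4) exterior)"
  "(bvec 1 \<and>\<^sub>e bvec 4) \<and>\<^sub>e (bvec 1 \<and>\<^sub>e bvec 4) = (0 :: (complex, 4) exterior)"
  "(bvec 1 \<and>\<^sub>e bvec 4) \<and>\<^sub>e (bvec 2 \<and>\<^sub>e bvec 3) = vol"
  "(bvec 1 \<and>\<^sub>e bvec 4) \<and>\<^sub>e (bvec 2 \<and>\<^sub>e bvec 4) = (0 :: (complex, 4) exterior)"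
  "(bvec 1 \<and>\<^sub>e bvec 4) \<and>\<^sub>e (bvec 3 \<and>\<^sub>e bvec 4) = (0 :: (complex, 4) exterior)"
  "(bvec 2 \<and>\<^sub>e bvec 3) \<and>\<^sub>e (bvec 1 \<and>\<^sub>e bvec 2) = (0 :: (complex, 4) exterior)"
  "(bvec 2 \<and>\<^sub>e bvec 3) \<and>\<^sub>e (bvec 1 \<and>\<^sub>e bvec 3) = (0 :: (complex, 4) exterior)"
  "(bvec 2 \<and>\<^sub>e bvec 3) \<and>\<^sub>e (bvec 1 \<and>\<^sub>e bvec 4) = vol"
  "(bvec 2 \<and>\<^sub>e bvec 3) \<and>\<^sub>e (bvec 2 \<and>\<^sub>e bvec 3) = (0 :: (complex, 4) exterior)"
  "(bvec 2 \<and>\<^sub>e bvec 3) \<and>\<^sub>e (bvec 2 \<and>\<^sub>e bvec 4) = (0 :: (complex, 4) exterior)"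
  "(bvec 2 \<and>\<^sub>e bvec 3) \<and>\<^sub>e (bvec 3 \<and>\<^sub>e bvec 4) = (0 :: (complex, 4) exterior)"
  unfolding vol_eq bvec_def UNIV_4
  by (simp_all add: wedge_axis shuffle_sign_prod less_4 not_less_4 distinct_4
      distinct_4[symmetric] wedge_scale_right wedge_scale_left wedge_uminus_right wedge_uminus_left
      insert_commute)

lemma wedge_bvec_4:
  "bvec 2 \<and>\<^sub>e bvec 1 = - (bvec 1 \<and>\<^sub>e (bvec 2 :: (complex, 4) exterior))"
  "bvec 3 \<and>\<^sub>e bvec 1 = - (bvec 1 \<and>\<^sub>e (bvec 3 :: (complex, 4) exterior))"
  "bvec 4 \<and>\<^sub>e bvec 1 = - (bvec 1 \<and>\<^sub>e (bvec 4 :: (complex, 4) exterior))"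
  "bvec 3 \<and>\<^sub>e bvec 2 = - (bvec 2 \<and>\<^sub>e (bvec 3 :: (complex, 4) exterior))"
  "bvec 4 \<and>\<^sub>e bvec 2 = - (bvec 2 \<and>\<^sub>e (bvec 4 :: (complex, 4) exterior))"
  "bvec 4 \<and>\<^sub>e bvec 3 = - (bvec 3 \<and>\<^sub>e (bvec 4 :: (complex, 4) exterior))"
  by (rule wedge_bvec)+

lemma vol_nonzero: "vol \<noteq> 0"
  by (simp add: vol_eq)

lemma K_eqI: "C \<and>\<^sub>e U = k *s vol \<Longrightarrow> K C U = k"
  unfolding K_def using vol_nonzero by auto

lemma det_X_minus_iY:
  "det (X_minus_iY Z) = (Z $ 1 $ 1 - \<i> * Z $ 3 $ 1) * (Z $ 2 $ 2 - \<i> * Z $ 4 $ 2)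
    - (Z $ 1 $ 2 - \<i> * Z $ 3 $ 2) * (Z $ 2 $ 1 - \<i> * Z $ 4 $ 1)"
  by (simp add: det_2 X_minus_iY_def upper_block_def lower_block_def)

lemma det_X_plus_iY: "det (X_plus_iY Z) = cnj (det (X_minus_iY Z))"
  by (simp add: det_2 X_minus_iY_def X_plus_iY_def)

lemma frame_wedge_expand:
  fixes Z :: "real ^ 2 ^ 4" and p :: "4 \<Rightarrow> 4 \<Rightarrow> complex"
  assumes p_def: "p = (\<lambda>i j. of_real (Z $ i $ 1 * Z $ j $ 2 - Z $ j $ 1 * Z $ i $ 2))"
  shows "frame_wedge Z =
      p 1 2 *s (bvec 1 \<and>\<^sub>e bvec 2) + p 1 3 *s (bvec 1 \<and>\<^sub>e bvec 3) + p 1 4 *s (bvec 1 \<and>\<^sub>e bvec 4)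
    + p 2 3 *s (bvec 2 \<and>\<^sub>e bvec 3) + p 2 4 *s (bvec 2 \<and>\<^sub>e bvec 4) + p 3 4 *s (bvec 3 \<and>\<^sub>e bvec 4)"
  apply (simp only: frame_wedge_def cvec_def sum_4 column_def wedge_add_left wedge_add_right
      wedge_scale_left wedge_scale_right wedge_bvec_self wedge_bvec_4 vec_lambda_beta)
  apply (simp only: p_def vec_eq_iff of_real_diff of_real_mult vector_add_component
      vector_smult_component vector_uminus_component zero_index)
  apply (simp add: algebra_simps)
  done

lemma standard_maslov_form_wedge:
  fixes p :: "4 \<Rightarrow> 4 \<Rightarrow> complex"
  shows "(p 1 2 - p 3 4 - \<i> * (p 1 4 - p 2 3)) *s vol = standard_maslov_form \<and>\<^sub>e
     (p 1 2 *s (bvec 1 \<and>\<^sub>e bvec 2) + p 1 3 *s (bvec 1 \<and>\<^sub>e bvec 3) + p 1 4 *s (bvec 1 \<and>\<^sub>e bvec 4)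
    + p 2 3 *s (bvec 2 \<and>\<^sub>e bvec 3) + p 2 4 *s (bvec 2 \<and>\<^sub>e bvec 4) + p 3 4 *s (bvec 3 \<and>\<^sub>e bvec 4))"
  unfolding standard_maslov_form_def
  apply (simp only: wedge_add_left wedge_add_right wedge_diff_left wedge_uminus_left
      wedge_scale_left wedge_scale_right wedge_basis_4)
  apply (simp only: vec_eq_iff vector_add_component vector_smult_component
      vector_minus_component vector_uminus_component zero_index)
  apply (simp add: algebra_simps)
  done

lemma homogeneous_standard_maslov_form: "homogeneous 2 standard_maslov_form"
proof -
  have "homogeneous 2 (bvec i \<and>\<^sub>e bvec j :: (complex, 4) exterior)" for i j
    using homogeneous_wedge[OF homogeneous_bvec homogeneous_bvec] by (simp add: numeral_2_eq_2)
  then have z: "(bvec i \<and>\<^sub>e bvec j :: (complex, 4) exterior) $ S = 0" if "card S \<noteq> 2" for i j S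
    using that by (auto simp: homogeneous_def)
  have "standard_maslov_form $ S = 0" if "card S \<noteq> 2" for S
    by (simp add: standard_maslov_form_def z[OF that])
  then show ?thesis
    unfolding homogeneous_def by blast
qed

lemma maslov_form_standard: "maslov_form standard_maslov_form"
proof -
  have "det (X_minus_iY Z) *s vol = standard_maslov_form \<and>\<^sub>e frame_wedge Z" for Z
  proof -
    define p :: "4 \<Rightarrow> 4 \<Rightarrow> complex"
      where "p = (\<lambda>i j. of_real (Z $ i $ 1 * Z $ j $ 2 - Z $ j $ 1 * Z $ i $ 2))"
    have "det (X_minus_iY Z) = p 1 2 - p 3 4 - \<i> * (p 1 4 - p 2 3)"
      by (simp add: det_X_minus_iY p_def algebra_simps)
    then show ?thesis
      unfolding frame_wedge_expand[OF p_def] by (simp only: standard_maslov_form_wedge)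
  qed
  then show ?thesis
    by (simp add: maslov_form_def homogeneous_standard_maslov_form)
qed

lemma lagrangian_frame_iff:
  "lagrangian_frame Z \<longleftrightarrow> rank Z = 2 \<and>
    Z $ 1 $ 1 * Z $ 3 $ 2 + Z $ 2 $ 1 * Z $ 4 $ 2 = Z $ 3 $ 1 * Z $ 1 $ 2 + Z $ 4 $ 1 * Z $ 2 $ 2"
  unfolding lagrangian_frame_def
  by (auto simp: inner_vec_def matrix_vector_mult_def sum_4 symplectic_J_def vector_4 column_def)

lemma det_X_minus_iY_nonzero:
  assumes "lagrangian_frame Z"
  shows "det (X_minus_iY Z) \<noteq> 0"
proof
  assume det0: "det (X_minus_iY Z) = 0"
  define z w where "z = column 1 Z" "w = column 2 Z"
  have nth: "z $ i = Z $ i $ 1" "w $ i = Z $ i $ 2" for i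
    by (simp_all add: z_w_def column_def)
  have "(z \<bullet> z) * (w \<bullet> w) - (z \<bullet> w)\<^sup>2 =
      (Re (det (X_minus_iY Z)))\<^sup>2 + (Im (det (X_minus_iY Z)))\<^sup>2 +
      (Z $ 1 $ 1 * Z $ 3 $ 2 + Z $ 2 $ 1 * Z $ 4 $ 2 - (Z $ 3 $ 1 * Z $ 1 $ 2 + Z $ 4 $ 1 * Z $ 2 $ 2))\<^sup>2"
    by (simp add: det_X_minus_iY inner_vec_def sum_4 nth) algebra
  also have "\<dots> = 0"
    using assms det0 by (simp add: lagrangian_frame_iff)
  finally have "(z \<bullet> w)\<^sup>2 = (z \<bullet> z) * (w \<bullet> w)"
    by simp
  then have "\<bar>z \<bullet> w\<bar> = norm z * norm w"
    by (subst power2_eq_iff_nonneg [symmetric])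
      (simp_all add: power_mult_distrib power2_norm_eq_inner)
  then have "collinear {0, z, w}"
    by (simp add: norm_cauchy_schwarz_equal)
  then obtain a b where ab: "(a, b) \<noteq> (0, 0)" "a *\<^sub>R z + b *\<^sub>R w = 0"
    by (metis collinear_lemma Pair_inject add.left_neutral add.right_neutral
        scaleR_zero_left scaleR_zero_right scaleR_one zero_neq_one scaleR_minus1_left add.right_inverse)
  define v :: "real ^ 2" where "v = vector [a, b]"
  have "Z *v v = a *\<^sub>R z + b *\<^sub>R w"
    by (simp add: vec_eq_iff matrix_vector_mult_def sum_2 v_def nth mult.commute)
  moreover have "inj ((*v) Z)"
    using assms by (simp add: full_rank_injective[symmetric] lagrangian_frame_def)
  ultimately have "v = 0"
    using ab by (metis injD matrix_vector_mult_0_right)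
  then have "v $ 1 = 0" "v $ 2 = 0"
    by simp_all
  then show False
    using ab by (simp add: v_def)
qed

lemma invertible_X_plus_iY:
  assumes "lagrangian_frame Z"
  shows "invertible (X_plus_iY Z)"
  using det_X_minus_iY_nonzero[OF assms] by (simp add: invertible_det_nz det_X_plus_iY)

lemma K_nonzero:
  assumes "maslov_form C" "lagrangian_frame Z"
  shows "K C (frame_wedge Z) \<noteq> 0"
  using assms det_X_minus_iY_nonzero by (metis K_eqI maslov_form_def)

lemma maslov_angle_exists:
  assumes "lagrangian_frame Z"
  shows "\<exists>\<kappa>. maslov_angle Z \<kappa>"
proof -
  let ?d = "det (X_minus_iY Z)" and ?P = "X_plus_iY Z"
  have "?P ** matrix_inv ?P = mat 1"
    using invertible_X_plus_iY[OF assms] unfolding invertible_def matrix_inv_def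
    by (rule someI2_ex) blast
  then have "det ?P * det (matrix_inv ?P) = 1"
    by (metis det_I det_mul)
  then have "norm (det ?P) * norm (det (matrix_inv ?P)) = 1"
    by (metis norm_mult norm_one)
  then have "norm (det (X_minus_iY Z ** matrix_inv ?P)) = 1"
    by (simp add: det_mul norm_mult det_X_plus_iY)
  then show ?thesis
    unfolding maslov_angle_def by (metis complex_norm_eq_1_exp)
qed

lemma maslov_angle_unique:
  assumes "maslov_angle Z \<kappa>"
  shows "maslov_angle Z \<kappa>' \<longleftrightarrow> (\<exists>n::int. \<kappa>' = \<kappa> + 2 * pi * n)"
proof -
  have "maslov_angle Z \<kappa>' \<longleftrightarrow> cis \<kappa>' = cis \<kappa>"
    using assms by (auto simp: maslov_angle_def cis_conv_exp)
  also have "\<dots> \<longleftrightarrow> (\<exists>n::int. \<kappa>' = \<kappa> + 2 * pi * n)"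
    using sin_cos_eq_iff[of \<kappa>' \<kappa>] by (auto simp: complex_eq_iff)
  finally show ?thesis .
qed

end

theory Submission
  imports Defs
begin

text \<open>
  Both sides are quotients of the same two numbers. Since \<open>X\<close> and \<open>Y\<close> are real, entrywise
  conjugation exchanges \<open>X - \<i>Y\<close> and \<open>X + \<i>Y\<close>, so their determinants are conjugate to each other,
  and multiplicativity of the determinant turns the definition of the Maslov angle into
  \<open>e\<^sup>i\<^sup>\<kappa> = det (X - \<i>Y) / cnj (det (X - \<i>Y))\<close>. The defining property of a Maslov form \<open>C\<close> says that the
  function \<open>K\<close> it induces takes the value \<open>det (X - \<i>Y)\<close> at every Lagrangian frame.

  The inverse in the definition of the angle is a genuine one because of the identity
  \<open>|det (X - \<i>Y)|\<^sup>2 + \<langle>J z\<^sub>1, z\<^sub>2\<rangle>\<^sup>2 = |z\<^sub>1|\<^sup>2 |z\<^sub>2|\<^sup>2 - \<langle>z\<^sub>1, z\<^sub>2\<rangle>\<^sup>2\<close>: the Gram determinant on the right is positive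
  by the rank condition, and the symplectic term vanishes for a Lagrangian frame. This is
  \<open>invertible_X_plus_iY\<close>.
\<close>

lemma K_frame_wedge:
  assumes "maslov_form C" "lagrangian_frame Z"
  shows "K C (frame_wedge Z) = det (X_minus_iY Z)"
  by (rule K_eqI) (use assms in \<open>simp add: maslov_form_def\<close>)

lemma det_matrix_inv:
  fixes A :: "'a::field ^ 'n ^ 'n"
  assumes "invertible A"
  shows "det (matrix_inv A) = inverse (det A)"
proof -
  have "A ** matrix_inv A = mat 1"
    using assms unfolding invertible_def matrix_inv_def by (rule someI2_ex) blast
  then have "det A * det (matrix_inv A) = 1"
    by (metis det_I det_mul)
  then show ?thesis
    by (simp add: inverse_unique)
qed

theorem proposition4:
  fixes Z :: "real ^ 2 ^ 4" and \<kappa> :: real and C :: "(complex, 4) exterior"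
  assumes "maslov_form C"
    and "lagrangian_frame Z"
    and "maslov_angle Z \<kappa>"
  shows "exp (\<i> * of_real \<kappa>) = K C (frame_wedge Z) / cnj (K C (frame_wedge Z))"
proof -
  have "exp (\<i> * of_real \<kappa>) = det (X_minus_iY Z ** matrix_inv (X_plus_iY Z))"
    using assms(3) by (simp add: maslov_angle_def)
  also have "\<dots> = det (X_minus_iY Z) / cnj (det (X_minus_iY Z))"
    using invertible_X_plus_iY[OF assms(2)]
    by (simp add: det_mul det_matrix_inv det_X_plus_iY divide_inverse)
  finally show ?thesis
    using assms(1,2) by (simp add: K_frame_wedge)
qed

end
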